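(* For every $\epsilon>0$ and all sufficiently large $x$ (depending on $\epsilon$), the number $\mathcal{P}_{\mathcal{C}}(x)$ of primitive covering numbers up to $x$ satisfies \[\mathcal{P}_{\mathcal{C}}(x)\le x\exp\left(\left(-\frac{1}{2\sqrt{\log 2}}+\epsilon\right)\sqrt{\log x}\,\log\log x\right).\]
   Context: A covering system is a finite set of pairs $(a_i,m_i)$ such that every integer satisfies at least one of the congruences $x\equiv a_i \pmod{m_i}$. It is distinct if each modulus is used at most once. A positive integer $n$ is a covering number if there exists a distinct covering system in which every modulus is a divisor of $n$ that is greater than $1$. A covering number $n$ is a primitive covering number if it is not divisible by any smaller covering number. $\mathcal{P}_{\mathcal{C}}(x)$ denotes the number of primitive covering numbers $n\le x$. *)

theory Defs
  imports Complex_Main "HOL-Number_Theory.Cong"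
begin

(* A pair (a, m) stands for the congruence x = a (mod m). Moduli are positive, so the
   degenerate congruence modulo 0, which only says x = a, is excluded. *)
definition covering_system :: "(int \<times> nat) set \<Rightarrow> bool" where
  "covering_system S \<longleftrightarrow>
     finite S \<and> (\<forall>(a, m)\<in>S. m > 0) \<and> (\<forall>x. \<exists>(a, m)\<in>S. [x = a] (mod int m))"

definition distinct_covering_system :: "(int \<times> nat) set \<Rightarrow> bool" where
  "distinct_covering_system S \<longleftrightarrow> covering_system S \<and> inj_on snd S"

definition covering_number :: "nat \<Rightarrow> bool" where
  "covering_number n \<longleftrightarrow>
     n > 0 \<and> (\<exists>S. distinct_covering_system S \<and> (\<forall>(a, m)\<in>S. m dvd n \<and> m > 1))"

definition primitive_covering_number :: "nat \<Rightarrow> bool" where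
  "primitive_covering_number n \<longleftrightarrow>
     covering_number n \<and> (\<forall>d. covering_number d \<and> d < n \<longrightarrow> \<not> d dvd n)"

definition primitive_covering_count :: "real \<Rightarrow> nat" where
  "primitive_covering_count x = card {n. primitive_covering_number n \<and> real n \<le> x}"

end

theory Submission
  imports Defs "HOL-Computational_Algebra.Squarefree" "HOL-Real_Asymp.Real_Asymp"
begin

text \<open>
  Write \<open>\<tau>(n)\<close> for the number of divisors of \<open>n\<close>, \<open>\<omega>(n)\<close> for the number of its distinct prime
  factors, and \<open>L = log x\<close>. A primitive covering number has so many divisors that there are few
  of its kind.

  Every prime factor \<open>p\<close> of a primitive covering number \<open>n\<close> satisfies \<open>p \<le> \<tau>(n)\<close>
  (lemma \<open>primitive_covering_number_prime_le\<close>). Indeed, if \<open>\<tau>(n) < p\<close>, then the congruences whose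
  modulus does not divide \<open>n/p\<close> are fewer than \<open>p\<close>, and a pigeonhole argument shows that the others
  already cover every integer; so \<open>n/p\<close> would be a smaller covering number dividing \<open>n\<close>.

  Consequently the squarefree part of \<open>n\<close> is at most \<open>\<tau>(n) ^ \<omega>(n)\<close>, and since
  \<open>2 ^ \<omega>(n) \<le> \<tau>(n)\<close>, its logarithm is at most \<open>(log \<tau>(n))\<^sup>2 / log 2\<close>. Apart from the few
  \<open>n \<le> x\<close> that are small or divisible by a large square, this logarithm is \<open>(1 + o(1)) L\<close>, so
  \<open>\<tau>(n) \<ge> Y\<close> for some \<open>Y = exp ((1 + o(1)) \<surd>(log 2) \<surd>L)\<close>
  (lemma \<open>primitive_covering_number_cases\<close>).

  Integers with that many divisors are rare by the method of moments. Expanding a Dirichlet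
  convolution gives \<open>\<Sum>n\<le>x. \<tau>(n)^k / n \<le> (1 + L)^(2^k)\<close>
  (lemma \<open>sum_num_divisors_power_le\<close>), and Markov's inequality, using \<open>1 \<le> x/n\<close>, bounds the number of
  \<open>n \<le> x\<close> with \<open>\<tau>(n) \<ge> Y\<close> by \<open>x (1 + L)^(2^k) / Y^k\<close>. For \<open>2^k\<close> close to \<open>\<surd>L / (log L)\<^sup>2\<close> the
  numerator contributes only \<open>exp (o(\<surd>L log L))\<close>, while \<open>k\<close> is asymptotic to
  \<open>log L / (2 log 2)\<close>, so that \<open>Y^k = exp ((1 + o(1)) \<surd>L log L / (2 \<surd>(log 2)))\<close>.
\<close>

definition num_divisors :: "nat \<Rightarrow> nat" where
  "num_divisors n = card {d. d dvd n}"

definition num_distinct_primes :: "nat \<Rightarrow> nat" where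
  "num_distinct_primes n = card (prime_factors n)"

section \<open>Prime factors of primitive covering numbers\<close>

text \<open>
  If \<open>x\<close> is missed by the congruences whose modulus divides \<open>q = n/p\<close>, then so are all the shifts
  \<open>x + j q\<close> with \<open>j < p\<close>. These \<open>p\<close> integers must be covered by the other congruences, which are fewer
  than \<open>p\<close> because their moduli are distinct divisors of \<open>n\<close>. So one modulus \<open>m\<close> divides
  \<open>(j - i) q\<close> with \<open>0 < j - i < p\<close>, and it also divides \<open>p q\<close>; as \<open>j - i\<close> is coprime to \<open>p\<close>, this
  forces \<open>m dvd q\<close>, a contradiction.
\<close>
lemma covering_number_div_prime:
  assumes n: "covering_number n" and p: "prime p" "p dvd n" and few: "num_divisors n < p"
  shows "covering_number (n div p)"
proof -
  define q where "q = n div p"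
  from n obtain S where S: "distinct_covering_system S" "\<forall>(a, m)\<in>S. m dvd n \<and> m > 1"
    and n0: "n > 0" by (auto simp: covering_number_def)
  have npq: "n = p * q" using p by (simp add: q_def)
  have q0: "q > 0" using n0 npq by (cases "q = 0") auto
  have fin: "finite S" and cov: "\<forall>x. \<exists>(a, m)\<in>S. [x = a] (mod int m)" and inj: "inj_on snd S"
    using S(1) by (auto simp: distinct_covering_system_def covering_system_def)
  define R where "R = {(a, m)\<in>S. m dvd q}"
  have RS: "R \<subseteq> S" by (auto simp: R_def)
  have covR: "\<exists>(a, m)\<in>R. [x = a] (mod int m)" for x
  proof (rule ccontr)
    assume un: "\<not> (\<exists>(a, m)\<in>R. [x = a] (mod int m))"
    have "\<exists>s. s \<in> S - R \<and> [x + int j * int q = fst s] (mod int (snd s))" for j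
    proof -
      obtain a m where am: "(a, m) \<in> S" "[x + int j * int q = a] (mod int m)"
        using cov by blast
      have "(a, m) \<notin> R"
      proof
        assume R: "(a, m) \<in> R"
        then have "int m dvd int j * int q" by (auto simp: R_def)
        then have "[x + int j * int q = x] (mod int m)"
          by (simp add: cong_iff_dvd_diff)
        then have "[x = a] (mod int m)" using am(2) by (meson cong_sym cong_trans)
        with R un show False by blast
      qed
      with am show ?thesis by (intro exI[of _ "(a, m)"]) auto
    qed
    then obtain F where F: "\<And>j. F j \<in> S - R"
        "\<And>j. [x + int j * int q = fst (F j)] (mod int (snd (F j)))"
      by metis
    have "card (S - R) \<le> card S" using fin by (intro card_mono) auto
    also have "\<dots> = card (snd ` S)" using inj by (simp add: card_image)
    also have "\<dots> \<le> card {d. d dvd n}" using S(2) n0 by (intro card_mono) auto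
    also have "\<dots> < card {..<p}" using few by (simp add: num_divisors_def)
    finally have card_less: "card (S - R) < card {..<p}" .
    have "card (F ` {..<p}) \<le> card (S - R)" using F(1) fin by (intro card_mono) auto
    with card_less have "\<not> inj_on F {..<p}" by (intro pigeonhole) auto
    then obtain i j where ij: "i < p" "j < p" "i < j" "F i = F j"
      by (smt (verit) inj_onI lessThan_iff linorder_neq_iff)
    obtain a m where Fi: "F i = (a, m)" by fastforce
    have amS: "(a, m) \<in> S" and amR: "(a, m) \<notin> R" using F(1)[of i] Fi by auto
    have "[x + int j * int q = x + int i * int q] (mod int m)"
      using F(2)[of i] F(2)[of j] ij(4) Fi by (metis cong_sym cong_trans fst_conv snd_conv)
    then have "int m dvd int ((j - i) * q)"
      using ij(3) by (simp add: cong_iff_dvd_diff algebra_simps of_nat_diff)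
    then have m1: "m dvd (j - i) * q" by (simp only: int_dvd_int_iff)
    have m2: "m dvd p * q" using S(2) amS npq by auto
    have "\<not> p dvd j - i" using ij by (auto dest: dvd_imp_le)
    then have "coprime p (j - i)" using p(1) by (simp add: prime_imp_coprime)
    then have "gcd ((j - i) * q) (p * q) = q"
      by (simp add: gcd_mult_distrib_nat[symmetric] mult.commute[of _ q] gcd.commute)
    with m1 m2 have "m dvd q" by (metis gcd_greatest)
    with amS amR show False by (simp add: R_def)
  qed
  have "distinct_covering_system R"
    using S(1) RS covR inj_on_subset[OF inj RS] finite_subset[OF RS fin]
    unfolding distinct_covering_system_def covering_system_def by blast
  moreover have "\<forall>(a, m)\<in>R. m dvd q \<and> m > 1" using S(2) by (auto simp: R_def)
  ultimately show ?thesis using q0 unfolding covering_number_def q_def[symmetric] by blast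
qed

lemma primitive_covering_number_prime_le:
  assumes "primitive_covering_number n" "prime p" "p dvd n"
  shows "p \<le> num_divisors n"
proof (rule ccontr)
  assume "\<not> p \<le> num_divisors n"
  then have "covering_number (n div p)"
    using assms by (intro covering_number_div_prime) (auto simp: primitive_covering_number_def)
  moreover have "n > 0" using assms by (simp add: primitive_covering_number_def covering_number_def)
  then have "n div p < n" "n div p dvd n"
    using assms(2,3) prime_gt_1_nat by (auto simp: div_dvd_iff_mult)
  ultimately show False using assms(1) by (auto simp: primitive_covering_number_def)
qed

section \<open>Moments with logarithmic weights\<close>

text \<open>
  The weights \<open>1/n\<close> are multiplicative, so the sum on the left is at most the sum over all
  pairs \<open>(a, b)\<close> with \<open>a b \<le> N\<close>; letting \<open>a\<close> and \<open>b\<close> both range up to \<open>N\<close> decouples them.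
\<close>
lemma sum_convolution_le:
  fixes f g h :: "nat \<Rightarrow> real"
  assumes "\<And>n. f n \<ge> 0" "\<And>n. g n \<ge> 0"
    and h: "\<And>n. n > 0 \<Longrightarrow> h n \<le> (\<Sum>d | d dvd n. f d * g (n div d))"
  shows "(\<Sum>n=1..N. h n / real n) \<le> (\<Sum>n=1..N. f n / real n) * (\<Sum>n=1..N. g n / real n)"
proof -
  have "(\<Sum>n=1..N. h n / real n) \<le> (\<Sum>n=1..N. \<Sum>d | d dvd n. f d * g (n div d) / real n)"
    using h by (intro sum_mono) (auto simp: sum_divide_distrib[symmetric] divide_right_mono)
  also have "\<dots> = (\<Sum>(n, d)\<in>Sigma {1..N} (\<lambda>n. {d. d dvd n}). f d * g (n div d) / real n)"
    by (subst sum.Sigma) auto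
  also have "\<dots> \<le> (\<Sum>(a, b)\<in>{1..N} \<times> {1..N}. (f a / real a) * (g b / real b))"
  proof (rule sum_le_included[where i = "\<lambda>(a, b). (a * b, a)"])
    show "\<forall>x\<in>Sigma {1..N} (\<lambda>n. {d. d dvd n}). \<exists>y\<in>{1..N} \<times> {1..N}. (case y of (a, b) \<Rightarrow> (a * b, a)) = x
      \<and> (case x of (n, d) \<Rightarrow> f d * g (n div d) / real n) \<le> (case y of (a, b) \<Rightarrow> f a / real a * (g b / real b))"
    proof clarify
      fix n d assume n: "n \<in> {1..N}" and "d dvd n"
      then obtain e where e: "n = d * e" by blast
      have "d > 0" "e > 0" "d \<le> n" "e \<le> n" using e n by auto
      moreover have "d \<le> N" "e \<le> N" using calculation n by auto
      ultimately show "\<exists>y\<in>{1..N} \<times> {1..N}. (case y of (a, b) \<Rightarrow> (a * b, a)) = (n, d)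
         \<and> f d * g (n div d) / real n \<le> (case y of (a, b) \<Rightarrow> f a / real a * (g b / real b))"
        using e n by (intro bexI[of _ "(d, e)"]) auto
    qed
  qed (use assms in auto)
  also have "\<dots> = (\<Sum>n=1..N. f n / real n) * (\<Sum>n=1..N. g n / real n)"
    by (simp add: sum_product sum.cartesian_product)
  finally show ?thesis .
qed

lemma sum_inverse_le:
  assumes "N > 0"
  shows "(\<Sum>n=1..N. 1 / real n) \<le> 1 + ln (real N)"
  using assms
proof (induction N rule: nat_induct_non_zero)
  case (Suc N)
  have "1 / real (Suc N) \<le> ln (real (Suc N)) - ln (real N)"
  proof -
    have "ln (real N / real (Suc N)) \<le> real N / real (Suc N) - 1"
      using Suc by (intro ln_le_minus_one) auto
    also have "\<dots> = - 1 / real (Suc N)" by (simp add: field_simps)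
    finally show ?thesis using Suc by (simp add: ln_div)
  qed
  with Suc show ?case by simp
qed simp

lemma num_divisors_mult_le:
  assumes "a > 0" "b > 0"
  shows "num_divisors (a * b) \<le> num_divisors a * num_divisors b"
proof -
  have "{d. d dvd a * b} \<subseteq> (\<lambda>(x, y). x * y) ` ({d. d dvd a} \<times> {d. d dvd b})"
    by (auto simp: image_iff dest!: division_decomp)
  then have "card {d. d dvd a * b} \<le> card ({d. d dvd a} \<times> {d. d dvd b})"
    using assms by (intro surj_card_le) auto
  then show ?thesis by (simp add: num_divisors_def card_cartesian_product)
qed

text \<open>
  Raising \<open>k\<close> by one squares the bound: one factor \<open>\<tau>(n)\<close> is opened up as a sum over the divisors
  \<open>d\<close> of \<open>n\<close>, and submultiplicativity distributes the other \<open>k\<close> factors over \<open>d\<close> and \<open>n/d\<close>.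
\<close>
lemma sum_num_divisors_power_le:
  "(\<Sum>n=1..N. real (num_divisors n) ^ k / real n) \<le> (\<Sum>n=1..N. 1 / real n) ^ (2 ^ k)"
proof (induction k)
  case (Suc k)
  have "(\<Sum>n=1..N. real (num_divisors n) ^ Suc k / real n) \<le>
     (\<Sum>n=1..N. real (num_divisors n) ^ k / real n) * (\<Sum>n=1..N. real (num_divisors n) ^ k / real n)"
  proof (rule sum_convolution_le)
    fix n :: nat assume n: "n > 0"
    have "real (num_divisors n) ^ Suc k = (\<Sum>d | d dvd n. real (num_divisors n) ^ k)"
      by (simp add: num_divisors_def)
    also have "\<dots> \<le> (\<Sum>d | d dvd n. real (num_divisors d) ^ k * real (num_divisors (n div d)) ^ k)"
    proof (rule sum_mono)
      fix d assume "d \<in> {d. d dvd n}"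
      then have "num_divisors n \<le> num_divisors d * num_divisors (n div d)"
        using n num_divisors_mult_le[of d "n div d"] by (auto elim!: dvdE)
      then have "real (num_divisors n) \<le> real (num_divisors d) * real (num_divisors (n div d))"
        by (metis of_nat_le_iff of_nat_mult)
      then show "real (num_divisors n) ^ k \<le> real (num_divisors d) ^ k * real (num_divisors (n div d)) ^ k"
        by (simp add: power_mono flip: power_mult_distrib)
    qed
    finally show "real (num_divisors n) ^ Suc k \<le> \<dots>" .
  qed auto
  also have "\<dots> \<le> (\<Sum>n=1..N. 1 / real n) ^ (2 ^ k) * (\<Sum>n=1..N. 1 / real n) ^ (2 ^ k)"
    using Suc by (intro mult_mono) (auto intro!: sum_nonneg zero_le_power)
  finally show ?case by (simp add: mult_2 power_add)
qed simp

section \<open>Counting exceptional integers\<close>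

text \<open>
  Markov's inequality, in a form where \<open>1 \<le> N/n\<close> pays for the logarithmic weights.
\<close>
lemma card_le_weighted_sum:
  fixes w :: "nat \<Rightarrow> real"
  assumes A: "A \<subseteq> {1..N}" and "\<And>n. w n \<ge> 0" and "c > 0" and w: "\<And>n. n \<in> A \<Longrightarrow> w n \<ge> c"
  shows "real (card A) \<le> real N * (\<Sum>n=1..N. w n / real n) / c"
proof -
  have "real (card A) = (\<Sum>n\<in>A. 1)" by simp
  also have "\<dots> \<le> (\<Sum>n\<in>A. real N / c * (w n / real n))"
  proof (rule sum_mono)
    fix n assume n: "n \<in> A"
    have "1 * 1 \<le> (real N / real n) * (w n / c)"
      using n A w[OF n] \<open>c > 0\<close> by (intro mult_mono) (auto simp: divide_simps)
    then show "1 \<le> real N / c * (w n / real n)" by (simp add: mult_ac)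
  qed
  also have "\<dots> \<le> (\<Sum>n=1..N. real N / c * (w n / real n))"
    using assms by (intro sum_mono2) auto
  finally show ?thesis by (simp add: sum_distrib_left sum_divide_distrib mult_ac)
qed

text \<open>
  The union bound over the possible square parts \<open>t\<close> gives \<open>N \<Sum>t>T. 1/t\<^sup>2\<close>. Estimating one of the
  two factors \<open>1/t\<close> by \<open>1/T\<close> loses a logarithm, which is harmless, and leaves a harmonic sum.
\<close>
lemma card_large_square_part_le:
  assumes "T > 0"
  shows "real (card {n\<in>{1..N}. real (square_part n) > T}) \<le> real N * (\<Sum>n=1..N. 1 / real n) / T"
proof -
  let ?M = "\<lambda>t. {n\<in>{1..N}. t\<^sup>2 dvd n}"
  let ?B = "{t\<in>{1..N}. real t > T}"
  have "{n\<in>{1..N}. real (square_part n) > T} \<subseteq> (\<Union>t\<in>?B. ?M t)"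
  proof
    fix n assume n: "n \<in> {n\<in>{1..N}. real (square_part n) > T}"
    then have pos: "square_part n > 0" by (intro Nat.gr0I) simp
    have "square_part n dvd n" by (rule dvd_trans[OF dvd_power square_part_square_dvd]) simp
    then have "square_part n \<in> ?B" using n pos by (auto dest: dvd_imp_le simp: Suc_le_eq)
    with n show "n \<in> (\<Union>t\<in>?B. ?M t)" by (intro UN_I[of "square_part n"]) auto
  qed
  then have "card {n\<in>{1..N}. real (square_part n) > T} \<le> card (\<Union>t\<in>?B. ?M t)"
    by (intro card_mono) auto
  also have "\<dots> \<le> (\<Sum>t\<in>?B. card (?M t))" by (rule card_UN_le) auto
  finally have "real (card {n\<in>{1..N}. real (square_part n) > T}) \<le> real (\<Sum>t\<in>?B. card (?M t))"
    by (rule of_nat_mono)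
  also have "\<dots> = (\<Sum>t\<in>?B. real (card (?M t)))" by (rule of_nat_sum)
  also have "\<dots> \<le> (\<Sum>t\<in>?B. real N / T * (1 / real t))"
  proof (rule sum_mono)
    fix t assume t: "t \<in> ?B"
    have "?M t \<subseteq> (\<lambda>k. t\<^sup>2 * k) ` {1..N div t\<^sup>2}"
    proof
      fix n assume "n \<in> ?M t"
      then have n: "n \<in> {1..N}" "t\<^sup>2 dvd n" by auto
      then obtain k where "n = t\<^sup>2 * k" by (elim dvdE)
      with n show "n \<in> (\<lambda>k. t\<^sup>2 * k) ` {1..N div t\<^sup>2}"
        using t by (intro image_eqI[of _ _ k]) (auto simp: less_eq_div_iff_mult_less_eq mult_ac)
    qed
    then have "card (?M t) \<le> card {1..N div t\<^sup>2}" by (intro surj_card_le) auto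
    then have "real (card (?M t)) \<le> real (N div t\<^sup>2)" by simp
    also have "\<dots> \<le> real N / real (t\<^sup>2)" by (rule of_nat_div_le_of_nat)
    also have "\<dots> \<le> real N / (T * real t)"
      using t \<open>T > 0\<close> by (intro divide_left_mono) (auto simp: power2_eq_square)
    finally show "real (card (?M t)) \<le> real N / T * (1 / real t)" by simp
  qed
  also have "\<dots> \<le> (\<Sum>t=1..N. real N / T * (1 / real t))"
    using \<open>T > 0\<close> by (intro sum_mono2) auto
  finally show ?thesis by (simp add: sum_distrib_left sum_divide_distrib mult_ac)
qed

section \<open>The squarefree part and the number of divisors\<close>

lemma smooth_squarefree_part_le:
  assumes "n > 0" "Y \<ge> 1" and smooth: "\<And>p. prime p \<Longrightarrow> p dvd n \<Longrightarrow> real p \<le> Y"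
  shows "real (squarefree_part n) \<le> Y ^ num_distinct_primes n"
proof -
  let ?m = "squarefree_part n"
  have m: "?m > 0" by (rule Nat.gr0I) simp
  have dvd: "?m dvd n" by (subst squarefree_decompose[of n]) simp
  have sub: "prime_factors ?m \<subseteq> prime_factors n" using dvd assms by (intro dvd_prime_factors) auto
  have "real ?m = real (\<Prod>p\<in>prime_factors ?m. p ^ multiplicity p ?m)"
    using prime_factorization_nat[OF m] by simp
  also have "\<dots> = (\<Prod>p\<in>prime_factors ?m. real p)"
    using m squarefree_factorial_semiring'[of ?m] by (simp add: of_nat_prod)
  also have "\<dots> \<le> (\<Prod>p\<in>prime_factors ?m. Y)"
    using sub smooth by (intro prod_mono) (auto simp: prime_factors_dvd)
  also have "\<dots> \<le> Y ^ num_distinct_primes n"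
    unfolding num_distinct_primes_def prod_constant
    using sub \<open>Y \<ge> 1\<close> by (intro power_increasing card_mono) auto
  finally show ?thesis .
qed

text \<open>
  Every set of prime factors of \<open>n\<close> is the set of prime factors of a divisor of \<open>n\<close>, namely of its
  product.
\<close>
lemma two_power_num_distinct_primes_le:
  assumes "n > 0"
  shows "2 ^ num_distinct_primes n \<le> num_divisors n"
proof -
  let ?P = "prime_factors n"
  have "Pow ?P \<subseteq> prime_factors ` {d. d dvd n}"
  proof
    fix A assume A: "A \<in> Pow ?P"
    then have fin: "finite A" by (auto intro: finite_subset)
    have pr: "\<And>p. p \<in> A \<Longrightarrow> prime p" using A by auto
    have "prime_factors (\<Prod>A) = \<Union> ((prime_factors \<circ> (\<lambda>x. x)) ` A)"
      using fin pr by (intro prime_factors_prod) (auto dest: pr)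
    also have "\<dots> = A" using pr by (auto simp: prime_factorization_prime)
    finally have factors: "prime_factors (\<Prod>A) = A" .
    have "\<Prod>A dvd \<Prod>?P" using A by (intro prod_dvd_prod_subset) auto
    also have "\<Prod>?P dvd (\<Prod>p\<in>?P. p ^ multiplicity p n)"
      using assms by (intro prod_dvd_prod dvd_power) (auto simp: prime_factors_multiplicity)
    also have "\<dots> = n" using prime_factorization_nat[of n] assms by simp
    finally have "\<Prod>A dvd n" .
    with factors show "A \<in> prime_factors ` {d. d dvd n}" by (intro image_eqI[of _ _ "\<Prod>A"]) auto
  qed
  then have "card (Pow ?P) \<le> card {d. d dvd n}" using assms by (intro surj_card_le) auto
  then show ?thesis by (simp add: card_Pow num_distinct_primes_def num_divisors_def)
qed

section \<open>An explicit upper bound for the counting function\<close>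

text \<open>
  Take \<open>n > x/T\<close> with square part at most \<open>T\<close>, so that the squarefree part exceeds \<open>x/T\<^sup>3\<close>. All primes
  of \<open>n\<close> are at most \<open>\<tau>(n)\<close>, so with \<open>t = ln \<tau>(n)\<close> the logarithm of the squarefree part is at most
  \<open>\<omega>(n) t \<le> t\<^sup>2 / ln 2\<close>. Solving \<open>ln x - 3 ln T \<le> t\<^sup>2 / ln 2\<close> for \<open>t\<close> gives the last case.
\<close>
lemma primitive_covering_number_cases:
  assumes n: "primitive_covering_number n" and T: "T > 0" and x: "x > 0"
  obtains (small) "real n \<le> x / T" | (square) "real (square_part n) > T"
    | (divisors) "real (num_divisors n) \<ge> exp (sqrt (ln 2 * (ln x - 3 * ln T)))"
proof -
  have n0: "n > 0" using n by (simp add: primitive_covering_number_def covering_number_def)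
  define t where "t = ln (real (num_divisors n))"
  have two_le: "2 ^ num_distinct_primes n \<le> num_divisors n"
    using n0 by (rule two_power_num_distinct_primes_le)
  then have div1: "real (num_divisors n) \<ge> 1"
    by (metis of_nat_1 of_nat_le_iff one_le_numeral one_le_power order.trans)
  then have t0: "t \<ge> 0" by (simp add: t_def)
  {
    assume 1: "real n > x / T" and 2: "real (square_part n) \<le> T"
    have sqf: "real (squarefree_part n) \<le> real (num_divisors n) ^ num_distinct_primes n"
      using n0 div1 primitive_covering_number_prime_le[OF n] by (intro smooth_squarefree_part_le) auto
    have "x / T < real (squarefree_part n) * real (square_part n) ^ 2"
      using 1 by (subst (asm) squarefree_decompose[of n]) simp
    also have "\<dots> \<le> real (num_divisors n) ^ num_distinct_primes n * T ^ 2"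
      using 2 sqf by (intro mult_mono power_mono) auto
    finally have "x < real (num_divisors n) ^ num_distinct_primes n * T ^ 3"
      using T by (simp add: divide_simps power2_eq_square power3_eq_cube mult_ac)
    then have "ln x < ln (real (num_divisors n) ^ num_distinct_primes n * T ^ 3)"
      using x by (subst ln_less_cancel_iff) auto
    also have "\<dots> = real (num_distinct_primes n) * t + 3 * ln T"
      using div1 T by (simp add: ln_mult ln_realpow t_def)
    finally have "ln 2 * (ln x - 3 * ln T) \<le> ln 2 * (real (num_distinct_primes n) * t)"
      by (intro mult_left_mono) auto
    also have "\<dots> = ln (2 ^ num_distinct_primes n) * t" by (simp add: ln_realpow)
    also have "\<dots> \<le> t * t"
    proof -
      have "(2::real) ^ num_distinct_primes n \<le> real (num_divisors n)"
        using two_le by (metis of_nat_le_iff of_nat_numeral of_nat_power)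
      then have "ln (2 ^ num_distinct_primes n) \<le> t"
        unfolding t_def using div1 by (subst ln_le_cancel_iff) auto
      then show ?thesis using t0 by (rule mult_right_mono)
    qed
    finally have "sqrt (ln 2 * (ln x - 3 * ln T)) \<le> t"
      using t0 by (intro real_le_lsqrt) (auto simp: power2_eq_square)
    then have "exp (sqrt (ln 2 * (ln x - 3 * ln T))) \<le> real (num_divisors n)"
      using div1 by (simp add: t_def ln_ge_iff)
  }
  then show thesis using that by fastforce
qed

text \<open>
  One summand for each of the three cases above; the moment order \<open>k\<close> and the threshold \<open>T\<close>
  remain free, to be optimised against \<open>x\<close>.
\<close>
lemma primitive_covering_count_le:
  assumes x: "x \<ge> 1" and T: "T > 0"
  defines "Y \<equiv> exp (sqrt (ln 2 * (ln x - 3 * ln T)))"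
  shows "real (primitive_covering_count x)
    \<le> x * (1 / T + (1 + ln x) / T + (1 + ln x) ^ (2 ^ k) / Y ^ k)"
proof -
  define N where "N = nat \<lfloor>x\<rfloor>"
  define H where "H = (\<Sum>n=1..N. 1 / real n)"
  have N: "N > 0" "real N \<le> x" using x by (auto simp: N_def of_nat_floor)
  have H0: "H \<ge> 0" by (auto simp: H_def intro: sum_nonneg)
  have H: "H \<le> 1 + ln x"
  proof -
    have "H \<le> 1 + ln (real N)" unfolding H_def by (rule sum_inverse_le) fact
    with N x show ?thesis by (smt (verit) ln_le_cancel_iff of_nat_0_less_iff)
  qed
  let ?small = "{n\<in>{1..N}. real n \<le> x / T}"
  let ?square = "{n\<in>{1..N}. real (square_part n) > T}"
  let ?divs = "{n\<in>{1..N}. real (num_divisors n) \<ge> Y}"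
  have "{n. primitive_covering_number n \<and> real n \<le> x} \<subseteq> ?small \<union> ?square \<union> ?divs"
  proof
    fix n assume "n \<in> {n. primitive_covering_number n \<and> real n \<le> x}"
    then have n: "primitive_covering_number n" "n \<in> {1..N}"
      by (auto simp: N_def le_nat_floor primitive_covering_number_def covering_number_def)
    have "x > 0" using x by simp
    with n(1) T show "n \<in> ?small \<union> ?square \<union> ?divs"
      by (cases rule: primitive_covering_number_cases) (use n(2) in \<open>auto simp: Y_def\<close>)
  qed
  then have "primitive_covering_count x \<le> card (?small \<union> ?square \<union> ?divs)"
    unfolding primitive_covering_count_def by (intro card_mono) auto
  also have "\<dots> \<le> card ?small + card ?square + card ?divs"
    by (meson card_Un_le order.trans add_right_mono)
  finally have "real (primitive_covering_count x)
      \<le> real (card ?small) + real (card ?square) + real (card ?divs)"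
    by linarith
  also have "real (card ?small) \<le> x * (1 / T)"
  proof -
    have "card ?small \<le> card {1..nat \<lfloor>x / T\<rfloor>}" by (intro card_mono) (auto simp: le_nat_floor)
    also have "real \<dots> \<le> x / T" using x T by (simp add: of_nat_floor)
    finally show ?thesis by simp
  qed
  also have "real (card ?square) \<le> x * ((1 + ln x) / T)"
  proof -
    have "real (card ?square) \<le> real N * H / T"
      unfolding H_def by (rule card_large_square_part_le) fact
    also have "\<dots> \<le> x * (1 + ln x) / T"
      using N H H0 x T by (intro divide_right_mono mult_mono) auto
    finally show ?thesis by simp
  qed
  also have "real (card ?divs) \<le> x * ((1 + ln x) ^ (2 ^ k) / Y ^ k)"
  proof -
    have Y: "Y > 0" by (simp add: Y_def)
    have "(\<Sum>n=1..N. real (num_divisors n) ^ k / real n) \<le> H ^ (2 ^ k)"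
      unfolding H_def by (rule sum_num_divisors_power_le)
    also have "\<dots> \<le> (1 + ln x) ^ (2 ^ k)" using H H0 by (rule power_mono)
    finally have moment: "(\<Sum>n=1..N. real (num_divisors n) ^ k / real n) \<le> (1 + ln x) ^ (2 ^ k)" .
    have "real (card ?divs) \<le> real N * (\<Sum>n=1..N. real (num_divisors n) ^ k / real n) / Y ^ k"
      using Y by (intro card_le_weighted_sum) (auto intro: power_mono)
    also have "\<dots> \<le> x * (1 + ln x) ^ (2 ^ k) / Y ^ k"
      using N x Y moment by (intro divide_right_mono mult_mono) (auto intro!: sum_nonneg)
    finally show ?thesis by simp
  qed
  finally show ?thesis by (simp add: algebra_simps)
qed

section \<open>Optimising the parameters\<close>

text \<open>
  Here \<open>L\<close> stands for \<open>ln x\<close> and \<open>J L\<close> for the approximate size of \<open>2 ^ k\<close>. The division by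
  \<open>(ln L)\<^sup>2\<close> makes \<open>J L * ln (1 + L)\<close> negligible against \<open>sqrt L * ln L\<close> while keeping
  \<open>ln (J L)\<close> asymptotic to \<open>ln L / 2\<close>. The choice \<open>T = exp (L powr (3/4))\<close> is large enough to beat
  the main saving and small enough that \<open>ln T\<close> is negligible against \<open>L\<close>. The term \<open>- 1\<close>
  next to \<open>ln (J L) / c\<^sup>2\<close> absorbs the rounding of \<open>k\<close> to an integer, and the terms \<open>ln 2\<close> leave room
  for adding up two contributions.
\<close>
lemma eventually_exponent_bounds:
  fixes c \<epsilon> :: real
  assumes "c > 0" "\<epsilon> > 0"
  defines "J \<equiv> \<lambda>L. sqrt L / (ln L)\<^sup>2" and "B \<equiv> \<lambda>L. (- (1 / (2 * c)) + \<epsilon>) * sqrt L * ln L"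
  shows "\<forall>\<^sub>F L in at_top. ln 2 + ln (2 + L) - L powr (3/4) \<le> B L" (is ?A)
    and "\<forall>\<^sub>F L in at_top. ln 2 + J L * ln (1 + L)
      - (ln (J L) / c\<^sup>2 - 1) * (c * sqrt (L - 3 * L powr (3/4))) \<le> B L" (is ?B)
    and "\<forall>\<^sub>F L in at_top. J L > 1 \<and> L > 1 \<and> L - 3 * L powr (3/4) > 0" (is ?C)
proof -
  show ?A unfolding B_def using assms(1,2) by real_asymp
  \<comment> \<open>The main terms cancel identically, leaving only \<open>\<epsilon>\<close>. Written in terms of \<open>1 / c\<close>, the
     coefficients are linear, and the cancellation becomes visible to \<open>real_asymp\<close>.\<close>
  define d where "d = 1 / c"
  have d: "d > 0" using assms by (simp add: d_def)
  have "\<forall>\<^sub>F L in at_top. ln 2 + J L * ln (1 + L) - (ln (J L) * d - c) * sqrt (L - 3 * L powr (3/4))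
      \<le> (- (d / 2) + \<epsilon>) * sqrt L * ln L"
    unfolding J_def using assms(1,2) d by real_asymp
  also have "(\<lambda>L. (ln (J L) * d - c) * sqrt (L - 3 * L powr (3/4)))
      = (\<lambda>L. (ln (J L) / c\<^sup>2 - 1) * (c * sqrt (L - 3 * L powr (3/4))))"
    using assms(1) by (auto simp: d_def field_simps power2_eq_square)
  finally show ?B by (simp add: B_def d_def mult.commute)
  show ?C unfolding J_def by (intro eventually_conj; real_asymp)
qed

theorem theorem2p3:
  fixes \<epsilon> :: real
  assumes "\<epsilon> > 0"
  shows "\<forall>\<^sub>F x :: real in at_top.
    real (primitive_covering_count x)
      \<le> x * exp ((- (1 / (2 * sqrt (ln 2))) + \<epsilon>) * sqrt (ln x) * ln (ln x))"
proof -
  define c :: real where "c = sqrt (ln 2)"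
  have c: "c > 0" "c\<^sup>2 = ln 2" by (auto simp: c_def)
  define J where "J L = sqrt L / (ln L)\<^sup>2" for L :: real
  define B where "B L = (- (1 / (2 * c)) + \<epsilon>) * sqrt L * ln L" for L :: real
  have ln_top: "filterlim (ln :: real \<Rightarrow> real) at_top at_top" by (rule ln_at_top)
  note ev = eventually_exponent_bounds[OF c(1) assms,
      THEN eventually_compose_filterlim, OF ln_top]
  have "\<forall>\<^sub>F x in at_top. real (primitive_covering_count x) \<le> x * exp (B (ln x))"
    using ev eventually_ge_at_top[of 1]
  proof eventually_elim
    case (elim x)
    define L where "L = ln x"
    define T where "T = exp (L powr (3/4))"
    define W where "W = c * sqrt (L - 3 * L powr (3/4))"
    define k where "k = nat \<lfloor>log 2 (J L)\<rfloor>"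
    have L: "L > 1" "J L > 1" "L - 3 * L powr (3/4) > 0"
      and B1: "ln 2 + ln (2 + L) - L powr (3/4) \<le> B L"
      and B2: "ln 2 + J L * ln (1 + L) - (ln (J L) / c\<^sup>2 - 1) * W \<le> B L"
      using elim(1-3) unfolding L_def J_def B_def W_def by blast+
    have W: "sqrt (ln 2 * (ln x - 3 * ln T)) = W" "W \<ge> 0"
      using L c by (auto simp: T_def W_def L_def c_def real_sqrt_mult)
    have "log 2 (J L) \<ge> 0" using L by simp
    then have k: "real k \<le> log 2 (J L)" "real k \<ge> log 2 (J L) - 1" unfolding k_def by linarith+
    have two_k: "2 ^ k \<le> J L"
      using k(1) L by (simp add: le_log_iff powr_realpow)
    have "1 / T + (1 + L) / T = exp (ln (2 + L) - L powr (3/4))"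
      using L by (simp add: exp_diff T_def add_divide_distrib[symmetric])
    also have "\<dots> = exp (ln 2 + ln (2 + L) - L powr (3/4)) / 2"
      using L by (simp add: exp_add exp_diff field_simps)
    also have "\<dots> \<le> exp (B L) / 2" using B1 by simp
    finally have 1: "1 / T + (1 + L) / T \<le> exp (B L) / 2" .
    have "(1 + L) ^ (2 ^ k) / exp W ^ k = exp (2 ^ k * ln (1 + L) - real k * W)"
      using L by (simp add: exp_diff exp_of_nat_mult[symmetric] flip: powr_realpow)
         (simp add: powr_def)
    also have "\<dots> \<le> exp (J L * ln (1 + L) - (ln (J L) / c\<^sup>2 - 1) * W)"
      using two_k k L c W by (auto intro!: diff_mono mult_right_mono simp: log_def)
    also have "\<dots> \<le> exp (B L - ln 2)" using B2 by simp
    finally have 2: "(1 + L) ^ (2 ^ k) / exp W ^ k \<le> exp (B L) / 2" by (simp add: exp_diff)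
    have x: "x \<ge> 1" by (rule elim)
    have T: "T > 0" by (simp add: T_def)
    have "real (primitive_covering_count x)
        \<le> x * (1 / T + (1 + L) / T + (1 + L) ^ (2 ^ k) / exp W ^ k)"
      using primitive_covering_count_le[OF x T, of k] by (simp only: L_def W)
    also have "\<dots> \<le> x * exp (B L)"
      using 1 2 x by (intro mult_left_mono) linarith+
    finally show ?case by (simp add: L_def)
  qed
  then show ?thesis by (simp add: B_def c_def)
qed

end
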